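(* Let $\mathcal S\subset\mathbb R^d$ be nonempty, closed and convex, and let $L:\mathcal S\to\mathbb R$ be bounded and Lipschitz continuous with constant $C_L$, i.e. $|L(\mathbf w_1)-L(\mathbf w_2)|\le C_L\|\mathbf w_1-\mathbf w_2\|$ for all $\mathbf w_1,\mathbf w_2\in\mathcal S$, with $\inf_{\mathbf w\in\mathcal S}L(\mathbf w)=L^*$. Let $\mathbf w_{in}$ be an $\mathcal S$-valued random vector with $\mathbb E[\|\mathbf w_{in}\|^2]<\infty$ and let $0<\varepsilon<1$. Then there exists a function $E:(0,\infty)\to\mathbb R$ with $\lim_{\beta\to\infty}E(\beta)=0$ such that the following holds. Suppose that the parameters satisfy $$\sigma>0,\qquad 2\lambda>\sigma^2,\qquad 0<h<\frac{2\lambda-\sigma^2}{\lambda^2},$$ and, with $m:=2\lambda-\lambda^2h-\sigma^2$, $$(1-\varepsilon)\,\mathbb E\big[e^{-\beta L(\mathbf w_{in})}\big]\ \ge\ \frac{\beta C_L e^{-\beta L^*}(d-1)(\lambda h+\sigma\sqrt h)}{d\,(1-e^{-hm/2})}\sqrt{2\,\mathrm{Var}(\mathbf w_{in})}.$$ Let $\{\mathbf w_n^i\}$ be a solution of the predictor-corrector CBO algorithm described in the context with these parameters and with initial data $\mathbf w_0^i$, $i\in[N]$, i.i.d. with the same distribution as $\mathbf w_{in}$, and let $\mathbf w_\infty$ be the common almost sure limit of $\mathbf w_n^i$ as $n\to\infty$. Then $$\operatorname*{ess\,inf}_{\omega\in\Omega}L(\mathbf w_\infty(\omega))\le\operatorname*{ess\,inf}_{\omega\in\Omega}L(\mathbf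 w_{in}(\omega))+E(\beta).$$ In particular, if a global minimizer $\mathbf w^*$ of $L$ is contained in the support of the law of $\mathbf w_{in}$, then $$\operatorname*{ess\,inf}_{\omega\in\Omega}L(\mathbf w_\infty(\omega))\le L^*+E(\beta).$$
   Context: Let $d,N\ge 1$ be integers, $[N]=\{1,\dots,N\}$, and $\|\cdot\|$ the Euclidean norm on $\mathbb R^d$. Let $\mathbb P_{\mathcal S}[\hat{\mathbf w}]:=\arg\min_{\mathbf w\in\mathcal S}\|\mathbf w-\hat{\mathbf w}\|^2$ be the projection onto $\mathcal S$, and let $\odot$ denote the componentwise (Hadamard) product. The parameters are the drift rate $\lambda$, the noise intensity $\sigma$, the time step $h>0$ and $\beta>0$. Write $\mathrm{Var}(\mathbf w_{in}):=\mathbb E[\|\mathbf w_{in}\|^2]-\|\mathbb E[\mathbf w_{in}]\|^2$. $\Omega$ is the underlying probability space. Noise: $\eta_n=(\eta_n^1,\dots,\eta_n^d)^\top$, $n\ge0$, where the real random variables $\eta_n^l$ ($n\ge 0$, $1\le l\le d$) are i.i.d. with $\mathbb E[\eta_n^l]=0$ and $\mathbb E[\eta_n^{l_1}\eta_k^{l_2}]=\delta_{l_1l_2}\delta_{nk}$. The same $\eta_n$ is used for all particles. The noise family is independent of the initial data $(\mathbf w_0^i)_{i\in[N]}$, so that for each $n$ the vector $\eta_n$ is independent of $(\mathbf w_k^i)_{k\le n,\,i\in[N]}$. Predictor-corrector CBO algorithm: starting from $\mathcal S$-valued random vectors $\mathbf w_0^i$, $i\in[N]$, for $n\ge0$ and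 $i\in[N]$, $$\hat{\mathbf w}^i_{n+1}=\mathbf w_n^i-\lambda h(\mathbf w_n^i-\bar{\mathbf w}_n)+\sigma\sqrt h\,(\mathbf w_n^i-\bar{\mathbf w}_n)\odot\eta_n,\qquad \mathbf w_{n+1}^i=\mathbb P_{\mathcal S}[\hat{\mathbf w}_{n+1}^i],$$ $$\bar{\mathbf w}_n:=\frac{\sum_{l=1}^N\mathbf w_n^l e^{-\beta L(\mathbf w_n^l)}}{\sum_{l=1}^N e^{-\beta L(\mathbf w_n^l)}}.$$ Under the stated conditions on $\lambda,\sigma,h$ there is a random vector $\mathbf w_\infty$ with $\mathbf w_n^i\to\mathbf w_\infty$ almost surely for every $i\in[N]$; this is the $\mathbf w_\infty$ of the claim. *)

theory Defs
  imports "HOL-Probability.Probability"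
begin

text \<open>
  The space R^d is \<open>real ^ 'd\<close> with d = \<open>CARD('d)\<close>. Multiplication on this type is componentwise, so
  \<open>*\<close> between vectors is the Hadamard product.
\<close>

definition proj :: "(real ^ 'd) set \<Rightarrow> real ^ 'd \<Rightarrow> real ^ 'd" where
  "proj S v = arg_min_on (\<lambda>u. (norm (u - v))\<^sup>2) S"

lemma proj_eq_closest_point: "proj S v = closest_point S v"
  unfolding proj_def closest_point_def arg_min_on_def arg_min_def is_arg_min_linorder
  by (simp add: dist_norm norm_minus_commute Ball_def)

text \<open>
  Values are extended reals, because the essential infimum of a real function may be infinite.
  Unlike \<^const>\<open>esssup\<close>, the definition has no default value for non-measurable functions, so it does
  not change when the function is altered on a null set, even if this destroys measurability. This
  matters for the composition of a function that is relevant only on a set \<open>S\<close> with a random vector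
  that lies in \<open>S\<close> only almost surely.
\<close>

definition ess_inf :: "'w measure \<Rightarrow> ('w \<Rightarrow> real) \<Rightarrow> ereal" where
  "ess_inf M f = Sup {z. AE \<omega> in M. z \<le> ereal (f \<omega>)}"

lemma ess_inf_eq_esssup:
  assumes [measurable]: "f \<in> borel_measurable M"
  shows "ess_inf M f = - esssup M (\<lambda>\<omega>. ereal (- f \<omega>))"
proof -
  have eq: "(ereal (- f \<omega>) \<le> z) = (- z \<le> ereal (f \<omega>))" for \<omega> z
    by (cases z) auto
  have "{z. AE \<omega> in M. ereal (- f \<omega>) \<le> z} = uminus ` {z. AE \<omega> in M. z \<le> ereal (f \<omega>)}"
    by (auto simp: eq image_iff intro!: exI[of _ "- z" for z])
  then show ?thesis
    by (subst esssup_eq_AE) (simp_all add: ess_inf_def ereal_Inf_uminus_image_eq)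
qed

definition vec_variance :: "'w measure \<Rightarrow> ('w \<Rightarrow> real ^ 'd) \<Rightarrow> real" where
  "vec_variance M X = (\<integral>\<omega>. (norm (X \<omega>))\<^sup>2 \<partial>M) - (norm (\<integral>\<omega>. X \<omega> \<partial>M))\<^sup>2"

definition measure_support :: "'a::topological_space measure \<Rightarrow> 'a set" where
  "measure_support \<mu> = {x. \<forall>U. open U \<longrightarrow> x \<in> U \<longrightarrow> emeasure \<mu> U > 0}"

text \<open>
  The last condition with equal indices makes every component square integrable, since the Bochner
  integral of a non-integrable function is 0; hence the means are genuine expectations as well.
\<close>

definition cbo_noise :: "'w measure \<Rightarrow> (nat \<Rightarrow> 'w \<Rightarrow> real ^ 'd) \<Rightarrow> bool" where
  "cbo_noise M \<eta> \<longleftrightarrow>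
     prob_space.indep_vars M (\<lambda>_. borel) (\<lambda>(n, l) \<omega>. \<eta> n \<omega> $ l) UNIV \<and>
     (\<forall>n k l\<^sub>1 l\<^sub>2. distr M borel (\<lambda>\<omega>. \<eta> n \<omega> $ l\<^sub>1) = distr M borel (\<lambda>\<omega>. \<eta> k \<omega> $ l\<^sub>2)) \<and>
     (\<forall>n l. (\<integral>\<omega>. \<eta> n \<omega> $ l \<partial>M) = 0) \<and>
     (\<forall>n k l\<^sub>1 l\<^sub>2. (\<integral>\<omega>. \<eta> n \<omega> $ l\<^sub>1 * \<eta> k \<omega> $ l\<^sub>2 \<partial>M) = (if l\<^sub>1 = l\<^sub>2 \<and> n = k then 1 else 0))"

definition weighted_mean :: "(real ^ 'd \<Rightarrow> real) \<Rightarrow> real \<Rightarrow> nat \<Rightarrow> (nat \<Rightarrow> real ^ 'd) \<Rightarrow> real ^ 'd" where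
  "weighted_mean L \<beta> N x =
     (\<Sum>l\<in>{1..N}. exp (- \<beta> * L (x l)) *\<^sub>R x l) /\<^sub>R (\<Sum>l\<in>{1..N}. exp (- \<beta> * L (x l)))"

definition cbo_predictor ::
  "real \<Rightarrow> real \<Rightarrow> real \<Rightarrow> real ^ 'd \<Rightarrow> real ^ 'd \<Rightarrow> real ^ 'd \<Rightarrow> real ^ 'd" where
  "cbo_predictor lam \<sigma> h x xbar e =
     x - (lam * h) *\<^sub>R (x - xbar) + (\<sigma> * sqrt h) *\<^sub>R ((x - xbar) * e)"

text \<open>
  \<open>w n i \<omega>\<close> is the position of particle \<open>i\<close> at step \<open>n\<close>; only \<open>i \<in> {1..N}\<close> is relevant. Independence of
  the noise family from the initial data is that of the two families as random elements of the
  product spaces.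
\<close>

definition cbo_solution ::
  "'w measure \<Rightarrow> (real ^ 'd) set \<Rightarrow> (real ^ 'd \<Rightarrow> real) \<Rightarrow> nat \<Rightarrow> real \<Rightarrow> real \<Rightarrow> real \<Rightarrow> real \<Rightarrow>
   (nat \<Rightarrow> 'w \<Rightarrow> real ^ 'd) \<Rightarrow> (nat \<Rightarrow> nat \<Rightarrow> 'w \<Rightarrow> real ^ 'd) \<Rightarrow> bool" where
  "cbo_solution M S L N lam \<sigma> h \<beta> \<eta> w \<longleftrightarrow>
     (\<forall>i\<in>{1..N}. w 0 i \<in> borel_measurable M \<and> (\<forall>\<omega>\<in>space M. w 0 i \<omega> \<in> S)) \<and>
     cbo_noise M \<eta> \<and>
     prob_space.indep_var M
       (Pi\<^sub>M UNIV (\<lambda>_. borel)) (\<lambda>\<omega> n. \<eta> n \<omega>)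
       (Pi\<^sub>M {1..N} (\<lambda>_. borel)) (\<lambda>\<omega>. \<lambda>i\<in>{1..N}. w 0 i \<omega>) \<and>
     (\<forall>n. \<forall>i\<in>{1..N}. \<forall>\<omega>\<in>space M.
        w (Suc n) i \<omega> =
          proj S (cbo_predictor lam \<sigma> h (w n i \<omega>) (weighted_mean L \<beta> N (\<lambda>l. w n l \<omega>)) (\<eta> n \<omega>)))"

end

theory Submission
  imports Defs
begin

text \<open>
  The function \<open>E = 0\<close> does it, for the following reason. Take a point \<open>x\<close> of \<open>S\<close> in the support of the
  law of the initial data. By independence, for every \<open>r > 0\<close> the event \<open>A\<close> that all \<open>N\<close> particles
  start in the ball of radius \<open>r\<close> around \<open>x\<close> has positive probability. Given \<open>A\<close>, the particles move
  by at most a constant times \<open>r\<close> in the mean, where the constant depends on the parameters but not on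
  \<open>r\<close>. Hence with positive probability the consensus point lies within a constant times \<open>r\<close> of \<open>x\<close>,
  and the Lipschitz bound gives \<open>ess_inf L(w_inf) \<le> L(x) + O(r)\<close>; then let \<open>r\<close> tend to 0
  (\<open>ess_inf_consensus_le\<close>). If \<open>x\<close> is a global minimizer, this is the second claim. The first follows
  because the value of the initial datum is almost surely such a point \<open>x\<close>
  (\<open>AE_in_measure_support\<close>), so \<open>ess_inf L(w_inf)\<close> is an almost sure lower bound of \<open>L(w_in)\<close>.

  The bound on the mean movement is a second moment computation. All particles share the noise and the
  weighted mean, so the predictors of two particles differ by
  \<open>(1 - lam h) D + \<sigma> sqrt h (D * \<eta>)\<close>, where \<open>D\<close> is the difference of their positions. The noise of a
  step is independent of the past, and its components are centred with unit variance, so the second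
  moment is multiplied exactly by \<open>\<rho> = (1 - lam h)\<^sup>2 + \<sigma>\<^sup>2 h\<close> (\<open>noise_second_moment\<close>).
  The projection does not increase distances, hence mean square distances given \<open>A\<close> decay like
  \<open>\<rho>\<^sup>n r\<^sup>2\<close> with \<open>\<rho> = 1 - h m < 1\<close> (\<open>particle_distance_contracts\<close>). A step is controlled by the
  distances to the other particles, so its conditional mean is \<open>O(r \<rho>\<^bsup>n/2\<^esup>)\<close>, which is summable
  (\<open>mean_displacement_le\<close>, \<open>mean_drift_le\<close>), and Fatou's lemma passes to the limit.

  Independence of the noise from the past is derived from the independence of the noise components and
  of the whole noise from the initial data by regrouping (\<open>indep_rvs_regroup\<close>).
\<close>

section \<open>Support of a measure\<close>

text \<open>
  The complement of the support is a union of open null sets; second countability makes it a countable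
  union of null basic sets.
\<close>

lemma AE_in_measure_support:
  fixes \<mu> :: "'a::second_countable_topology measure"
  assumes "sets \<mu> = sets borel"
  shows "AE x in \<mu>. x \<in> measure_support \<mu>"
proof -
  obtain B :: "'a set set" where B: "countable B" "topological_basis B"
    using ex_countable_basis[where 'a='a] by blast
  define D where "D = {b \<in> B. emeasure \<mu> b = 0}"
  have "D \<subseteq> null_sets \<mu>"
    using B(2) assms by (auto simp: D_def null_sets_def dest: topological_basis_open)
  then have "(\<Union>b\<in>D. b) \<in> null_sets \<mu>"
    using null_sets_UN'[of D "\<lambda>b. b" \<mu>] countable_subset[OF _ B(1), of D]
    by (auto simp: D_def)
  moreover have "x \<in> (\<Union>b\<in>D. b)" if "x \<notin> measure_support \<mu>" for x
  proof -
    from that obtain U where U: "open U" "x \<in> U" "emeasure \<mu> U = 0"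
      by (auto simp: measure_support_def)
    obtain b where b: "b \<in> B" "x \<in> b" "b \<subseteq> U"
      using topological_basisE[OF B(2) U(1,2)] .
    have "emeasure \<mu> b = 0"
      using emeasure_mono[OF b(3), of \<mu>] U assms by simp
    with b show ?thesis
      by (auto simp: D_def)
  qed
  ultimately show ?thesis
    by (rule AE_I'[OF _ subsetI]) auto
qed

section \<open>Independence of random variables with different value types\<close>

text \<open>
  This is \<^const>\<open>prob_space.indep_var\<close>, except that the two value types may differ. The past of the
  particle system consists of noise components and initial positions and is compared with a single
  real noise component, so the types are genuinely different.
\<close>

definition (in prob_space) indep_rvs where
  "indep_rvs S X T Y \<longleftrightarrow> X \<in> measurable M S \<and> Y \<in> measurable M T \<and>
     (\<forall>A\<in>sets S. \<forall>B\<in>sets T. emeasure M {\<omega>\<in>space M. X \<omega> \<in> A \<and> Y \<omega> \<in> B} =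
        emeasure M {\<omega>\<in>space M. X \<omega> \<in> A} * emeasure M {\<omega>\<in>space M. Y \<omega> \<in> B})"

lemma (in prob_space) indep_rvs_measurable:
  assumes "indep_rvs S X T Y"
  shows "X \<in> measurable M S" "Y \<in> measurable M T"
  using assms by (auto simp: indep_rvs_def)

lemma (in prob_space) indep_rvs_distr:
  assumes indep: "indep_rvs S X T Y"
  shows "distr M S X \<Otimes>\<^sub>M distr M T Y = distr M (S \<Otimes>\<^sub>M T) (\<lambda>\<omega>. (X \<omega>, Y \<omega>))"
proof (rule pair_measure_eqI)
  note [measurable] = indep_rvs_measurable[OF indep]
  interpret X: prob_space "distr M S X" by (rule prob_space_distr) simp
  interpret Y: prob_space "distr M T Y" by (rule prob_space_distr) simp
  show "sigma_finite_measure (distr M S X)" "sigma_finite_measure (distr M T Y)"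
    by unfold_locales
  fix A B assume "A \<in> sets (distr M S X)" "B \<in> sets (distr M T Y)"
  then have [measurable]: "A \<in> sets S" "B \<in> sets T" by auto
  have "{\<omega>\<in>space M. X \<omega> \<in> A \<and> Y \<omega> \<in> B} = (\<lambda>\<omega>. (X \<omega>, Y \<omega>)) -` (A \<times> B) \<inter> space M"
    "{\<omega>\<in>space M. X \<omega> \<in> A} = X -` A \<inter> space M" "{\<omega>\<in>space M. Y \<omega> \<in> B} = Y -` B \<inter> space M"
    by auto
  moreover have "emeasure M {\<omega>\<in>space M. X \<omega> \<in> A \<and> Y \<omega> \<in> B} =
      emeasure M {\<omega>\<in>space M. X \<omega> \<in> A} * emeasure M {\<omega>\<in>space M. Y \<omega> \<in> B}"
    using indep \<open>A \<in> sets S\<close> \<open>B \<in> sets T\<close> by (simp add: indep_rvs_def)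
  ultimately show "emeasure (distr M S X) A * emeasure (distr M T Y) B =
      emeasure (distr M (S \<Otimes>\<^sub>M T) (\<lambda>\<omega>. (X \<omega>, Y \<omega>))) (A \<times> B)"
    by (simp add: emeasure_distr)
qed (simp cong: sets_pair_measure_cong)

lemma (in prob_space) indep_var_imp_indep_rvs:
  assumes indep: "indep_var S X T Y"
    and f: "f \<in> measurable S S'" and g: "g \<in> measurable T T'"
  shows "indep_rvs S' (\<lambda>\<omega>. f (X \<omega>)) T' (\<lambda>\<omega>. g (Y \<omega>))"
  unfolding indep_rvs_def
proof (intro conjI ballI)
  have X: "X \<in> measurable M S" and Y: "Y \<in> measurable M T"
    using indep_var_rv1[OF indep] indep_var_rv2[OF indep] by auto
  show "(\<lambda>\<omega>. f (X \<omega>)) \<in> measurable M S'" "(\<lambda>\<omega>. g (Y \<omega>)) \<in> measurable M T'"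
    using X Y f g by (auto intro: measurable_compose)
  fix A B assume A: "A \<in> sets S'" and B: "B \<in> sets T'"
  have sets: "f -` A \<inter> space S \<in> sets S" "g -` B \<inter> space T \<in> sets T"
    using f g A B by (auto intro: measurable_sets)
  have eqs: "(\<lambda>\<omega>. (X \<omega>, Y \<omega>)) -` ((f -` A \<inter> space S) \<times> (g -` B \<inter> space T)) \<inter> space M
      = {\<omega>\<in>space M. f (X \<omega>) \<in> A \<and> g (Y \<omega>) \<in> B}"
    "X -` (f -` A \<inter> space S) \<inter> space M = {\<omega>\<in>space M. f (X \<omega>) \<in> A}"
    "Y -` (g -` B \<inter> space T) \<inter> space M = {\<omega>\<in>space M. g (Y \<omega>) \<in> B}"
    using measurable_space[OF X] measurable_space[OF Y] by auto
  show "emeasure M {\<omega>\<in>space M. f (X \<omega>) \<in> A \<and> g (Y \<omega>) \<in> B} =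
      emeasure M {\<omega>\<in>space M. f (X \<omega>) \<in> A} * emeasure M {\<omega>\<in>space M. g (Y \<omega>) \<in> B}"
    using indep_varD[OF indep sets] unfolding eqs
    by (simp add: emeasure_eq_measure ennreal_mult)
qed

text \<open>
  If \<open>(X, Y)\<close> is independent of \<open>W\<close> and \<open>X\<close> of \<open>Y\<close>, then \<open>X, Y, W\<close> are mutually independent. With \<open>X\<close> the
  earlier noise, \<open>Y\<close> the current noise component and \<open>W\<close> the initial data, the conclusion says that
  the current noise is independent of everything that determines the particle positions. The proof
  slices an event of the joint law at each value of \<open>W\<close> and factorises every slice.
\<close>

lemma (in prob_space) indep_rvs_regroup:
  assumes indep: "indep_rvs (B \<Otimes>\<^sub>M C) (\<lambda>\<omega>. (X \<omega>, Y \<omega>)) A W"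
    and XY: "indep_rvs B X C Y"
  shows "indep_rvs (B \<Otimes>\<^sub>M A) (\<lambda>\<omega>. (X \<omega>, W \<omega>)) C Y"
  unfolding indep_rvs_def
proof (intro conjI ballI)
  have rv [measurable]: "X \<in> measurable M B" "Y \<in> measurable M C" "W \<in> measurable M A"
    using indep_rvs_measurable[OF XY] indep_rvs_measurable[OF indep] by auto
  show "(\<lambda>\<omega>. (X \<omega>, W \<omega>)) \<in> measurable M (B \<Otimes>\<^sub>M A)" "Y \<in> measurable M C"
    by simp_all
  have XW: "indep_rvs B X A W"
    unfolding indep_rvs_def
  proof (intro conjI ballI rv)
    fix F G assume F: "F \<in> sets B" and G: "G \<in> sets A"
    from F have "F \<times> space C \<in> sets (B \<Otimes>\<^sub>M C)" by simp
    with indep G have "emeasure M {\<omega> \<in> space M. (X \<omega>, Y \<omega>) \<in> F \<times> space C \<and> W \<omega> \<in> G} =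
        emeasure M {\<omega> \<in> space M. (X \<omega>, Y \<omega>) \<in> F \<times> space C} * emeasure M {\<omega> \<in> space M. W \<omega> \<in> G}"
      unfolding indep_rvs_def by blast
    moreover have "{\<omega> \<in> space M. (X \<omega>, Y \<omega>) \<in> F \<times> space C} = {\<omega> \<in> space M. X \<omega> \<in> F}"
      "{\<omega> \<in> space M. (X \<omega>, Y \<omega>) \<in> F \<times> space C \<and> W \<omega> \<in> G} = {\<omega> \<in> space M. X \<omega> \<in> F \<and> W \<omega> \<in> G}"
      using measurable_space[OF rv(2)] by auto
    ultimately show "emeasure M {\<omega> \<in> space M. X \<omega> \<in> F \<and> W \<omega> \<in> G} =
        emeasure M {\<omega> \<in> space M. X \<omega> \<in> F} * emeasure M {\<omega> \<in> space M. W \<omega> \<in> G}"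
      by (simp only:)
  qed
  interpret X: prob_space "distr M B X" by (rule prob_space_distr) simp
  interpret Y: prob_space "distr M C Y" by (rule prob_space_distr) simp
  interpret W: prob_space "distr M A W" by (rule prob_space_distr) simp
  interpret XYp: prob_space "distr M (B \<Otimes>\<^sub>M C) (\<lambda>\<omega>. (X \<omega>, Y \<omega>))" by (rule prob_space_distr) simp
  interpret P: pair_sigma_finite "distr M B X" "distr M A W" ..
  interpret Q: pair_sigma_finite "distr M (B \<Otimes>\<^sub>M C) (\<lambda>\<omega>. (X \<omega>, Y \<omega>))" "distr M A W" ..
  note dXY = indep_rvs_distr[OF XY] and dXW = indep_rvs_distr[OF XW] and dXYW = indep_rvs_distr[OF indep]
  fix D E assume [measurable]: "D \<in> sets (B \<Otimes>\<^sub>M A)" "E \<in> sets C"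
  \<comment> \<open>the event \<open>(X, W) \<in> D, Y \<in> E\<close>, transported to the bracketing \<open>((X, Y), W)\<close>\<close>
  define D' where "D' = {p \<in> space ((B \<Otimes>\<^sub>M C) \<Otimes>\<^sub>M A). (fst (fst p), snd p) \<in> D \<and> snd (fst p) \<in> E}"
  have D' [measurable]: "D' \<in> sets ((B \<Otimes>\<^sub>M C) \<Otimes>\<^sub>M A)"
    unfolding D'_def by measurable
  have slice: "(\<lambda>p. (p, a)) -` D' = ((\<lambda>b. (b, a)) -` D) \<times> E" if "a \<in> space A" for a
    using that sets.sets_into_space[OF \<open>D \<in> _\<close>] sets.sets_into_space[OF \<open>E \<in> _\<close>]
    by (auto simp: D'_def space_pair_measure)
  have "{\<omega> \<in> space M. (X \<omega>, W \<omega>) \<in> D \<and> Y \<omega> \<in> E} = (\<lambda>\<omega>. ((X \<omega>, Y \<omega>), W \<omega>)) -` D' \<inter> space M"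
    using rv[THEN measurable_space] by (auto simp: D'_def space_pair_measure)
  then have "emeasure M {\<omega> \<in> space M. (X \<omega>, W \<omega>) \<in> D \<and> Y \<omega> \<in> E}
      = emeasure (distr M ((B \<Otimes>\<^sub>M C) \<Otimes>\<^sub>M A) (\<lambda>\<omega>. ((X \<omega>, Y \<omega>), W \<omega>))) D'"
    by (simp add: emeasure_distr)
  also have "\<dots> = (\<integral>\<^sup>+a. emeasure (distr M (B \<Otimes>\<^sub>M C) (\<lambda>\<omega>. (X \<omega>, Y \<omega>))) ((\<lambda>p. (p, a)) -` D') \<partial>distr M A W)"
    unfolding dXYW[symmetric] by (rule Q.emeasure_pair_measure_alt2) (simp add: dXYW)
  also have "\<dots> = (\<integral>\<^sup>+a. emeasure (distr M B X) ((\<lambda>b. (b, a)) -` D) * emeasure (distr M C Y) E \<partial>distr M A W)"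
  proof (rule nn_integral_cong)
    fix a assume a: "a \<in> space (distr M A W)"
    have "(\<lambda>b. (b, a)) -` D \<in> sets B"
      using sets_Pair2[OF \<open>D \<in> _\<close>] .
    then show "emeasure (distr M (B \<Otimes>\<^sub>M C) (\<lambda>\<omega>. (X \<omega>, Y \<omega>))) ((\<lambda>p. (p, a)) -` D') =
       emeasure (distr M B X) ((\<lambda>b. (b, a)) -` D) * emeasure (distr M C Y) E"
      using a unfolding dXY[symmetric]
      by (subst slice) (auto intro!: Y.emeasure_pair_measure_Times)
  qed
  also have "\<dots> = (\<integral>\<^sup>+a. emeasure (distr M B X) ((\<lambda>b. (b, a)) -` D) \<partial>distr M A W) * emeasure (distr M C Y) E"
    by (rule nn_integral_multc) (rule P.measurable_emeasure_Pair2, simp add: dXW)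
  also have "(\<integral>\<^sup>+a. emeasure (distr M B X) ((\<lambda>b. (b, a)) -` D) \<partial>distr M A W)
      = emeasure (distr M (B \<Otimes>\<^sub>M A) (\<lambda>\<omega>. (X \<omega>, W \<omega>))) D"
    unfolding dXW[symmetric] by (rule P.emeasure_pair_measure_alt2[symmetric]) (simp add: dXW)
  also have "\<dots> = emeasure M {\<omega> \<in> space M. (X \<omega>, W \<omega>) \<in> D}"
    by (simp add: emeasure_distr vimage_def Int_def conj_commute)
  also have "emeasure (distr M C Y) E = emeasure M {\<omega> \<in> space M. Y \<omega> \<in> E}"
    by (simp add: emeasure_distr vimage_def Int_def conj_commute)
  finally show "emeasure M {\<omega> \<in> space M. (X \<omega>, W \<omega>) \<in> D \<and> Y \<omega> \<in> E} =
      emeasure M {\<omega> \<in> space M. (X \<omega>, W \<omega>) \<in> D} * emeasure M {\<omega> \<in> space M. Y \<omega> \<in> E}" .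
qed

lemma (in prob_space) indep_rvs_vimage_algebra:
  assumes ZY: "indep_rvs T Z C Y" and V: "V \<in> measurable (vimage_algebra (space M) Z T) B"
  shows "indep_rvs B V C Y"
  unfolding indep_rvs_def
proof (intro conjI ballI)
  have Z: "Z \<in> measurable M T" and Y: "Y \<in> measurable M C"
    using indep_rvs_measurable[OF ZY] by auto
  have Zs: "Z \<in> space M \<rightarrow> space T"
    using measurable_space[OF Z] by auto
  have ex: "\<exists>F\<in>sets T. V -` A \<inter> space M = Z -` F \<inter> space M" if "A \<in> sets B" for A
    using measurable_sets[OF V that] by (auto simp: sets_vimage_algebra2[OF Zs])
  show "V \<in> measurable M B"
  proof (rule measurableI)
    show "V \<omega> \<in> space B" if "\<omega> \<in> space M" for \<omega>
      using measurable_space[OF V] that by simp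
    show "V -` A \<inter> space M \<in> sets M" if "A \<in> sets B" for A
      using ex[OF that] Z by (auto intro: measurable_sets)
  qed
  show "Y \<in> measurable M C" by fact
  fix A E assume "A \<in> sets B" and E: "E \<in> sets C"
  with ex obtain F where F: "F \<in> sets T" "V -` A \<inter> space M = Z -` F \<inter> space M" by blast
  then have "{\<omega> \<in> space M. V \<omega> \<in> A} = {\<omega> \<in> space M. Z \<omega> \<in> F}"
    "{\<omega> \<in> space M. V \<omega> \<in> A \<and> Y \<omega> \<in> E} = {\<omega> \<in> space M. Z \<omega> \<in> F \<and> Y \<omega> \<in> E}"
    by (auto simp: set_eq_iff)
  with ZY F E show "emeasure M {\<omega> \<in> space M. V \<omega> \<in> A \<and> Y \<omega> \<in> E} =
      emeasure M {\<omega> \<in> space M. V \<omega> \<in> A} * emeasure M {\<omega> \<in> space M. Y \<omega> \<in> E}"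
    by (simp add: indep_rvs_def)
qed

lemma (in prob_space) indep_rvs_nn_integral_mult:
  assumes XY: "indep_rvs S X T Y"
    and f [measurable]: "f \<in> borel_measurable S" and g [measurable]: "g \<in> borel_measurable T"
  shows "(\<integral>\<^sup>+\<omega>. f (X \<omega>) * g (Y \<omega>) \<partial>M) = (\<integral>\<^sup>+\<omega>. f (X \<omega>) \<partial>M) * (\<integral>\<^sup>+\<omega>. g (Y \<omega>) \<partial>M)"
proof -
  have [measurable]: "X \<in> measurable M S" "Y \<in> measurable M T"
    using indep_rvs_measurable[OF XY] by auto
  interpret Y: prob_space "distr M T Y" by (rule prob_space_distr) simp
  have "(\<integral>\<^sup>+\<omega>. f (X \<omega>) * g (Y \<omega>) \<partial>M)
      = (\<integral>\<^sup>+p. f (fst p) * g (snd p) \<partial>distr M (S \<Otimes>\<^sub>M T) (\<lambda>\<omega>. (X \<omega>, Y \<omega>)))"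
    by (subst nn_integral_distr) auto
  also have "\<dots> = (\<integral>\<^sup>+p. f (fst p) * g (snd p) \<partial>(distr M S X \<Otimes>\<^sub>M distr M T Y))"
    by (simp add: indep_rvs_distr[OF XY])
  also have "\<dots> = (\<integral>\<^sup>+x. \<integral>\<^sup>+y. f x * g y \<partial>distr M T Y \<partial>distr M S X)"
    by (subst Y.nn_integral_fst[symmetric]) auto
  also have "\<dots> = (\<integral>\<^sup>+\<omega>. f (X \<omega>) \<partial>M) * (\<integral>\<^sup>+\<omega>. g (Y \<omega>) \<partial>M)"
    by (simp add: nn_integral_cmult nn_integral_multc nn_integral_distr)
  finally show ?thesis .
qed

section \<open>One step of the algorithm\<close>

text \<open>
  In each component the vector becomes \<open>V (c + s Y)\<close>, and \<open>(c + s Y)\<^sup>2\<close> has mean \<open>c\<^sup>2 + s\<^sup>2\<close>, because the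
  cross term is killed by the zero mean of \<open>Y\<close>. The nonnegative integral makes the identity
  meaningful even when \<open>V\<close> is not square integrable.
\<close>

lemma (in prob_space) noise_second_moment:
  fixes V Y :: "'a \<Rightarrow> real ^ 'd"
  assumes indep: "\<And>l. indep_rvs borel (\<lambda>\<omega>. V \<omega> $ l) borel (\<lambda>\<omega>. Y \<omega> $ l)"
    and mean: "\<And>l. expectation (\<lambda>\<omega>. Y \<omega> $ l) = 0"
    and var: "\<And>l. expectation (\<lambda>\<omega>. (Y \<omega> $ l)\<^sup>2) = 1"
  shows "(\<integral>\<^sup>+\<omega>. ennreal ((norm (c *\<^sub>R V \<omega> + s *\<^sub>R (V \<omega> * Y \<omega>)))\<^sup>2) \<partial>M)
    = ennreal (c\<^sup>2 + s\<^sup>2) * (\<integral>\<^sup>+\<omega>. ennreal ((norm (V \<omega>))\<^sup>2) \<partial>M)"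
proof -
  have norm_sq: "ennreal ((norm v)\<^sup>2) = (\<Sum>l\<in>UNIV. ennreal ((v $ l)\<^sup>2))" for v :: "real ^ 'd"
    by (simp add: norm_vec_def L2_set_def real_sqrt_pow2 sum_nonneg)
  have V [measurable]: "(\<lambda>\<omega>. V \<omega> $ l) \<in> borel_measurable M"
    and Y [measurable]: "(\<lambda>\<omega>. Y \<omega> $ l) \<in> borel_measurable M" for l
    using indep_rvs_measurable[OF indep] by auto
  have factor: "(\<integral>\<^sup>+\<omega>. ennreal ((c + s * Y \<omega> $ l)\<^sup>2) \<partial>M) = ennreal (c\<^sup>2 + s\<^sup>2)" for l
  proof -
    \<comment> \<open>a non-integrable function would have integral 0, not 1\<close>
    have i2: "integrable M (\<lambda>\<omega>. (Y \<omega> $ l)\<^sup>2)"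
      using var[of l] not_integrable_integral_eq by fastforce
    then have i1: "integrable M (\<lambda>\<omega>. Y \<omega> $ l)"
      by (rule square_integrable_imp_integrable[rotated]) simp
    have eq: "(c + s * y)\<^sup>2 = c\<^sup>2 + 2 * c * s * y + s\<^sup>2 * y\<^sup>2" for y :: real
      by (simp add: power2_eq_square algebra_simps)
    have "(\<integral>\<^sup>+\<omega>. ennreal ((c + s * Y \<omega> $ l)\<^sup>2) \<partial>M) = ennreal (expectation (\<lambda>\<omega>. (c + s * Y \<omega> $ l)\<^sup>2))"
    proof (rule nn_integral_eq_integral)
      show "integrable M (\<lambda>\<omega>. (c + s * Y \<omega> $ l)\<^sup>2)"
        using i1 i2 by (simp add: eq)
    qed simp
    also have "expectation (\<lambda>\<omega>. (c + s * Y \<omega> $ l)\<^sup>2) = c\<^sup>2 + s\<^sup>2"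
      using i1 i2 mean[of l] var[of l] by (simp add: eq prob_space)
    finally show ?thesis .
  qed
  have comp: "(\<integral>\<^sup>+\<omega>. ennreal (((c *\<^sub>R V \<omega> + s *\<^sub>R (V \<omega> * Y \<omega>)) $ l)\<^sup>2) \<partial>M)
    = ennreal (c\<^sup>2 + s\<^sup>2) * (\<integral>\<^sup>+\<omega>. ennreal ((V \<omega> $ l)\<^sup>2) \<partial>M)" for l
  proof -
    have entry: "((c *\<^sub>R V \<omega> + s *\<^sub>R (V \<omega> * Y \<omega>)) $ l)\<^sup>2
        = (V \<omega> $ l)\<^sup>2 * (c + s * Y \<omega> $ l)\<^sup>2" for \<omega>
      by (simp add: power2_eq_square algebra_simps)
    have "(\<integral>\<^sup>+\<omega>. ennreal (((c *\<^sub>R V \<omega> + s *\<^sub>R (V \<omega> * Y \<omega>)) $ l)\<^sup>2) \<partial>M)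
      = (\<integral>\<^sup>+\<omega>. ennreal ((V \<omega> $ l)\<^sup>2) * ennreal ((c + s * Y \<omega> $ l)\<^sup>2) \<partial>M)"
      by (simp only: entry ennreal_mult zero_le_power2)
    also have "\<dots> = (\<integral>\<^sup>+\<omega>. ennreal ((V \<omega> $ l)\<^sup>2) \<partial>M) * (\<integral>\<^sup>+\<omega>. ennreal ((c + s * Y \<omega> $ l)\<^sup>2) \<partial>M)"
      by (rule indep_rvs_nn_integral_mult[OF indep, where f="\<lambda>v. ennreal (v\<^sup>2)" and g="\<lambda>y. ennreal ((c + s * y)\<^sup>2)"]) auto
    finally show ?thesis
      by (simp add: factor mult.commute)
  qed
  show ?thesis
    unfolding norm_sq using V Y
    by (subst (1 2) nn_integral_sum) (simp_all only: comp sum_distrib_left, simp_all)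
qed

text \<open>
  The weighted mean is a convex combination of the particles, so it stays in every ball around \<open>z\<close> that
  contains them all; the root of the sum of squares is such a radius, and it does not depend on \<open>L\<close>
  or \<open>\<beta>\<close>.
\<close>

lemma norm_diff_weighted_mean_le:
  fixes x :: "nat \<Rightarrow> real ^ 'd"
  assumes "N \<ge> 1"
  shows "(norm (z - weighted_mean L \<beta> N x))\<^sup>2 \<le> (\<Sum>l\<in>{1..N}. (norm (z - x l))\<^sup>2)"
proof -
  define R where "R = sqrt (\<Sum>l\<in>{1..N}. (norm (z - x l))\<^sup>2)"
  define W where "W = (\<Sum>l\<in>{1..N}. exp (- \<beta> * L (x l)))"
  have W: "W > 0"
    unfolding W_def using assms by (intro sum_pos) auto
  have mem: "x l \<in> cball z R" if "l \<in> {1..N}" for l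
    using that unfolding R_def
    by (auto simp: dist_norm intro!: real_le_rsqrt member_le_sum)
  have "(\<Sum>l\<in>{1..N}. (exp (- \<beta> * L (x l)) / W) *\<^sub>R x l) \<in> cball z R"
    using W by (intro convex_sum mem) (auto simp: W_def sum_divide_distrib[symmetric])
  also have "(\<Sum>l\<in>{1..N}. (exp (- \<beta> * L (x l)) / W) *\<^sub>R x l) = weighted_mean L \<beta> N x"
    unfolding weighted_mean_def W_def[symmetric] scaleR_sum_right
    by (simp add: divide_inverse mult.commute)
  finally have "norm (z - weighted_mean L \<beta> N x) \<le> R"
    by (simp add: dist_norm)
  then have "(norm (z - weighted_mean L \<beta> N x))\<^sup>2 \<le> R\<^sup>2"
    by (rule power_mono) simp
  then show ?thesis
    by (simp add: R_def sum_nonneg)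
qed

lemma continuous_cbo_predictor:
  "continuous_on UNIV (\<lambda>(x :: real ^ 'd, y, e). cbo_predictor lam \<sigma> h x y e)"
  unfolding cbo_predictor_def times_vec_def case_prod_beta
  by (intro continuous_intros)

lemma measurable_vecI:
  fixes f :: "'a \<Rightarrow> real ^ 'd"
  assumes "\<And>l. (\<lambda>\<omega>. f \<omega> $ l) \<in> borel_measurable K"
  shows "f \<in> borel_measurable K"
  using assms by (subst borel_measurable_euclidean_space) (auto simp: Basis_vec_def inner_axis)

lemma predictor_diff:
  "cbo_predictor lam \<sigma> h x y e - cbo_predictor lam \<sigma> h x' y e =
    (1 - lam * h) *\<^sub>R (x - x') + (\<sigma> * sqrt h) *\<^sub>R ((x - x') * e)"
  unfolding cbo_predictor_def by (simp add: algebra_simps)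

lemma predictor_displacement:
  "cbo_predictor lam \<sigma> h x y e - x =
    (- (lam * h)) *\<^sub>R (x - y) + (\<sigma> * sqrt h) *\<^sub>R ((x - y) * e)"
  unfolding cbo_predictor_def by (simp add: algebra_simps)

section \<open>The particle system and its past\<close>

locale cbo_run = prob_space M
  for M :: "'w measure" +
  fixes S :: "(real ^ 'd) set" and L :: "real ^ 'd \<Rightarrow> real" and N :: nat
    and lam \<sigma> h \<beta> :: real
    and \<eta> :: "nat \<Rightarrow> 'w \<Rightarrow> real ^ 'd" and w :: "nat \<Rightarrow> nat \<Rightarrow> 'w \<Rightarrow> real ^ 'd"
  assumes S: "S \<noteq> {}" "closed S" "convex S"
    and contL: "continuous_on S L"
    and Npos: "N \<ge> 1"
    and pos: "h > 0" "\<sigma> > 0"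
    and contraction: "(1 - lam * h)\<^sup>2 + \<sigma>\<^sup>2 * h < 1"
    and sol: "cbo_solution M S L N lam \<sigma> h \<beta> \<eta> w"
begin

text \<open>
  Only the particles with index in \<open>{1..N}\<close> are random variables, so the initial positions are
  recorded as a function restricted to this set.
\<close>

definition history :: "nat \<Rightarrow> 'w \<Rightarrow> (nat \<times> 'd \<Rightarrow> real) \<times> (nat \<Rightarrow> real ^ 'd)" where
  "history n = (\<lambda>\<omega>. (restrict (\<lambda>(k, l). \<eta> k \<omega> $ l) ({..<n} \<times> UNIV), \<lambda>i\<in>{1..N}. w 0 i \<omega>))"

definition past :: "nat \<Rightarrow> 'w measure" where
  "past n = vimage_algebra (space M) (history n)
     (Pi\<^sub>M ({..<n} \<times> UNIV) (\<lambda>_. borel) \<Otimes>\<^sub>M Pi\<^sub>M {1..N} (\<lambda>_. borel))"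

abbreviation wbar :: "nat \<Rightarrow> 'w \<Rightarrow> real ^ 'd" where
  "wbar n \<omega> \<equiv> weighted_mean L \<beta> N (\<lambda>l. w n l \<omega>)"

lemma space_past [simp]: "space (past n) = space M"
  by (simp add: past_def)

lemma history_space: "history n \<in> space M \<rightarrow> space (Pi\<^sub>M ({..<n} \<times> UNIV) (\<lambda>_. borel) \<Otimes>\<^sub>M Pi\<^sub>M {1..N} (\<lambda>_. borel))"
  by (auto simp: history_def space_pair_measure space_PiM)

lemma history_measurable: "history n \<in> measurable (past n)
    (Pi\<^sub>M ({..<n} \<times> UNIV) (\<lambda>_. borel) \<Otimes>\<^sub>M Pi\<^sub>M {1..N} (\<lambda>_. borel))"
  unfolding past_def by (rule measurable_vimage_algebra1[OF history_space])

lemma noise_measurable_past: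
  assumes "k < n"
  shows "(\<lambda>\<omega>. \<eta> k \<omega> $ l) \<in> borel_measurable (past n)"
proof -
  have "(\<lambda>\<omega>. fst (history n \<omega>) (k, l)) \<in> borel_measurable (past n)"
    by (rule measurable_compose[OF measurable_compose[OF history_measurable measurable_fst]
          measurable_component_singleton]) (use assms in auto)
  then show ?thesis
    using assms by (simp add: history_def)
qed

lemma initial_measurable_past:
  assumes "i \<in> {1..N}"
  shows "w 0 i \<in> borel_measurable (past n)"
proof -
  have "(\<lambda>\<omega>. snd (history n \<omega>) i) \<in> borel_measurable (past n)"
    by (rule measurable_compose[OF measurable_compose[OF history_measurable measurable_snd]
          measurable_component_singleton]) (use assms in auto)
  then show ?thesis
    using assms by (simp add: history_def)
qed

lemma past_mono:
  assumes f: "f \<in> measurable (past n) B" and "n \<le> n'"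
  shows "f \<in> measurable (past n') B"
proof -
  have "history n \<in> measurable (past n')
    (Pi\<^sub>M ({..<n} \<times> UNIV) (\<lambda>_. borel) \<Otimes>\<^sub>M Pi\<^sub>M {1..N} (\<lambda>_. borel))"
    unfolding history_def using \<open>n \<le> n'\<close>
    by (intro measurable_Pair measurable_restrict)
       (auto intro!: noise_measurable_past initial_measurable_past)
  then have "(\<lambda>\<omega>. \<omega>) \<in> measurable (past n') (past n)"
    by (subst (2) past_def, intro measurable_vimage_algebra2) auto
  from measurable_compose[OF this f] show ?thesis
    by simp
qed

lemma in_S:
  assumes "i \<in> {1..N}" "\<omega> \<in> space M"
  shows "w n i \<omega> \<in> S"
  using assms sol S
  by (cases n) (auto simp: cbo_solution_def proj_eq_closest_point closest_point_in_set)

lemma step: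
  assumes "i \<in> {1..N}" "\<omega> \<in> space M"
  shows "w (Suc n) i \<omega> = closest_point S (cbo_predictor lam \<sigma> h (w n i \<omega>) (wbar n \<omega>) (\<eta> n \<omega>))"
  using assms sol by (simp add: cbo_solution_def proj_eq_closest_point)

text \<open>
  Nothing is known about \<open>L\<close> off \<open>S\<close>, and it need not be measurable there. Since the particles stay in
  \<open>S\<close>, it may be replaced by its composition with the projection, which is continuous everywhere.
\<close>

lemma wbar_measurable:
  assumes w: "\<And>l. l \<in> {1..N} \<Longrightarrow> w n l \<in> borel_measurable (past n)"
  shows "wbar n \<in> borel_measurable (past n)"
proof -
  have cont: "continuous_on UNIV (\<lambda>x. L (closest_point S x))"
    using closest_point_in_set[OF S(2,1)]
    by (intro continuous_on_compose2[OF contL continuous_on_closest_point[OF S(3,2,1)]]) auto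
  have L: "(\<lambda>\<omega>. L (w n l \<omega>)) \<in> borel_measurable (past n)" if l: "l \<in> {1..N}" for l
  proof -
    have "(\<lambda>\<omega>. L (closest_point S (w n l \<omega>))) \<in> borel_measurable (past n)"
      using measurable_compose[OF w[OF l] borel_measurable_continuous_onI[OF cont]] .
    then show ?thesis
      by (rule measurable_cong[THEN iffD1, rotated]) (simp add: closest_point_self[OF in_S[OF l]])
  qed
  show ?thesis
    unfolding weighted_mean_def
    by (intro borel_measurable_scaleR borel_measurable_inverse borel_measurable_sum
        borel_measurable_exp borel_measurable_times borel_measurable_const L w measurable_compose[OF _ borel_measurable_exp])
qed

lemma adapted: "i \<in> {1..N} \<Longrightarrow> w n i \<in> borel_measurable (past n)"
proof (induction n arbitrary: i)
  case 0
  then show ?case by (rule initial_measurable_past)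
next
  case (Suc n)
  have \<eta>: "\<eta> n \<in> borel_measurable (past (Suc n))"
    by (intro measurable_vecI noise_measurable_past) simp
  have "(\<lambda>\<omega>. (w n i \<omega>, wbar n \<omega>, \<eta> n \<omega>)) \<in> borel_measurable (past (Suc n))"
    by (intro borel_measurable_Pair \<eta> past_mono[OF wbar_measurable[OF Suc.IH]]
        past_mono[OF Suc.IH[OF Suc.prems]]) auto
  from measurable_compose[OF this borel_measurable_continuous_onI[OF continuous_cbo_predictor[of lam \<sigma> h]]]
  have "(\<lambda>\<omega>. closest_point S (cbo_predictor lam \<sigma> h (w n i \<omega>) (wbar n \<omega>) (\<eta> n \<omega>)))
      \<in> borel_measurable (past (Suc n))"
    using measurable_compose[OF _ borel_measurable_continuous_onI[OF continuous_on_closest_point[OF S(3,2,1)]]]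
    by simp
  then show ?case
    by (rule measurable_cong[THEN iffD1, rotated]) (simp add: step[OF Suc.prems])
qed

lemma noise_indep_history:
  "indep_rvs (Pi\<^sub>M ({..<n} \<times> UNIV) (\<lambda>_. borel) \<Otimes>\<^sub>M Pi\<^sub>M {1..N} (\<lambda>_. borel)) (history n)
     borel (\<lambda>\<omega>. \<eta> n \<omega> $ l)"
proof -
  let ?X = "\<lambda>\<omega>. restrict (\<lambda>p. case p of (k, l) \<Rightarrow> \<eta> k \<omega> $ l) ({..<n} \<times> UNIV)"
  have comp: "indep_vars (\<lambda>_. borel) (\<lambda>(n, l) \<omega>. \<eta> n \<omega> $ l) UNIV"
    using sol by (simp add: cbo_solution_def cbo_noise_def)
  have "indep_var (Pi\<^sub>M ({..<n} \<times> UNIV) (\<lambda>_. borel)) ?X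
      (Pi\<^sub>M {(n, l)} (\<lambda>_. borel)) (\<lambda>\<omega>. restrict (\<lambda>p. case p of (k, l) \<Rightarrow> \<eta> k \<omega> $ l) {(n, l)})"
    using indep_var_restrict[OF comp, of "{..<n} \<times> UNIV" "{(n, l)}"] by (auto simp: case_prod_beta)
  from indep_var_imp_indep_rvs[OF this measurable_ident measurable_component_singleton[OF insertI1]]
  have XY: "indep_rvs (Pi\<^sub>M ({..<n} \<times> UNIV) (\<lambda>_. borel)) ?X borel (\<lambda>\<omega>. \<eta> n \<omega> $ l)"
    by simp
  have init: "indep_var (Pi\<^sub>M UNIV (\<lambda>_. borel)) (\<lambda>\<omega> n. \<eta> n \<omega>)
       (Pi\<^sub>M {1..N} (\<lambda>_. borel)) (\<lambda>\<omega>. \<lambda>i\<in>{1..N}. w 0 i \<omega>)"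
    using sol by (simp add: cbo_solution_def)
  have ev: "(\<lambda>e. e k $ l) \<in> borel_measurable (Pi\<^sub>M UNIV (\<lambda>_. borel :: (real ^ 'd) measure))" for k :: nat and l
    by (rule measurable_compose[OF measurable_component_singleton]) auto
  have "(\<lambda>e. (restrict (\<lambda>p. case p of (k, l) \<Rightarrow> e k $ l) ({..<n} \<times> UNIV), e n $ l))
      \<in> measurable (Pi\<^sub>M UNIV (\<lambda>_. borel :: (real ^ 'd) measure))
         (Pi\<^sub>M ({..<n} \<times> UNIV) (\<lambda>_. borel) \<Otimes>\<^sub>M borel)"
  proof (intro measurable_Pair measurable_restrict ev)
    show "(\<lambda>e. case p of (k, l) \<Rightarrow> e k $ l) \<in> borel_measurable (Pi\<^sub>M UNIV (\<lambda>_. borel :: (real ^ 'd) measure))"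
      for p :: "nat \<times> 'd"
      by (cases p) (simp add: ev)
  qed
  from indep_var_imp_indep_rvs[OF init this measurable_ident]
  have "indep_rvs (Pi\<^sub>M ({..<n} \<times> UNIV) (\<lambda>_. borel) \<Otimes>\<^sub>M borel) (\<lambda>\<omega>. (?X \<omega>, \<eta> n \<omega> $ l))
      (Pi\<^sub>M {1..N} (\<lambda>_. borel)) (\<lambda>\<omega>. \<lambda>i\<in>{1..N}. w 0 i \<omega>)"
    by simp
  from indep_rvs_regroup[OF this XY] show ?thesis
    by (simp add: history_def)
qed

lemma noise_step_moment:
  assumes V: "V \<in> borel_measurable (past n)"
  shows "(\<integral>\<^sup>+\<omega>. ennreal ((norm (c *\<^sub>R V \<omega> + s *\<^sub>R (V \<omega> * \<eta> n \<omega>)))\<^sup>2) \<partial>M)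
    = ennreal (c\<^sup>2 + s\<^sup>2) * (\<integral>\<^sup>+\<omega>. ennreal ((norm (V \<omega>))\<^sup>2) \<partial>M)"
proof (rule noise_second_moment)
  show "indep_rvs borel (\<lambda>\<omega>. V \<omega> $ l) borel (\<lambda>\<omega>. \<eta> n \<omega> $ l)" for l
  proof (rule indep_rvs_vimage_algebra[OF noise_indep_history])
    have "(\<lambda>\<omega>. V \<omega> $ l) \<in> borel_measurable (past n)"
      using measurable_compose[OF V borel_measurable_nth] .
    then show "(\<lambda>\<omega>. V \<omega> $ l) \<in> borel_measurable (vimage_algebra (space M) (history n)
       (Pi\<^sub>M ({..<n} \<times> UNIV) (\<lambda>_. borel) \<Otimes>\<^sub>M Pi\<^sub>M {1..N} (\<lambda>_. borel)))"
      by (simp add: past_def)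
  qed
  show "expectation (\<lambda>\<omega>. \<eta> n \<omega> $ l) = 0" "expectation (\<lambda>\<omega>. (\<eta> n \<omega> $ l)\<^sup>2) = 1" for l
    using sol by (simp_all add: cbo_solution_def cbo_noise_def power2_eq_square)
qed


section \<open>Contraction and total movement\<close>

text \<open>
  \<open>\<rho>\<close> is the factor by which mean square distances between particles shrink in a step, and \<open>\<kappa>\<close>
  compares the mean square step of a particle with its mean square distance to the weighted mean.
\<close>

abbreviation \<rho> :: real where "\<rho> \<equiv> (1 - lam * h)\<^sup>2 + \<sigma>\<^sup>2 * h"
abbreviation \<kappa> :: real where "\<kappa> \<equiv> (lam * h)\<^sup>2 + \<sigma>\<^sup>2 * h"

lemma \<rho>_pos: "\<rho> > 0"
  using pos by (simp add: add_nonneg_pos)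

lemma \<kappa>_nonneg: "\<kappa> \<ge> 0"
  using pos by simp

lemma past_subalgebra:
  assumes "f \<in> borel_measurable (past n)"
  shows "f \<in> borel_measurable M"
proof -
  have "history n \<in> measurable M (Pi\<^sub>M ({..<n} \<times> UNIV) (\<lambda>_. borel) \<Otimes>\<^sub>M Pi\<^sub>M {1..N} (\<lambda>_. borel))"
    using indep_rvs_measurable[OF noise_indep_history] by blast
  then have "(\<lambda>\<omega>. \<omega>) \<in> measurable M (past n)"
    unfolding past_def by (intro measurable_vimage_algebra2) auto
  from measurable_compose[OF this assms] show ?thesis
    by simp
qed

lemma w_measurable: "i \<in> {1..N} \<Longrightarrow> w n i \<in> borel_measurable M"
  by (rule past_subalgebra[OF adapted])

lemma indicator_measurable:
  assumes "A \<in> sets (past 0)"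
  shows "(indicator A :: 'w \<Rightarrow> real) \<in> borel_measurable (past n)"
  by (rule past_mono[of _ 0]) (use assms in auto)

lemma initial_event:
  assumes "A \<in> sets (past 0)"
  shows "A \<in> sets M"
proof -
  have "(indicator A :: 'w \<Rightarrow> real) \<in> borel_measurable M"
    using indicator_measurable[OF assms] by (rule past_subalgebra)
  then have "A \<inter> space M \<in> sets M"
    by (simp add: borel_measurable_indicator_iff)
  moreover have "A \<subseteq> space M"
    using sets.sets_into_space[OF assms] by simp
  ultimately show ?thesis
    by (simp add: Int_absorb2)
qed

text \<open>
  The event \<open>A\<close> is decided by the initial data, so its indicator can be absorbed into the vector that
  multiplies the noise without destroying independence. This replaces conditioning on \<open>A\<close>.
\<close>

lemma conditional_step_moment_le:
  assumes A: "A \<in> sets (past 0)"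
    and D: "D \<in> borel_measurable (past n)"
    and le: "\<And>\<omega>. \<omega> \<in> space M \<Longrightarrow> norm (F \<omega>) \<le> norm (c *\<^sub>R D \<omega> + (\<sigma> * sqrt h) *\<^sub>R (D \<omega> * \<eta> n \<omega>))"
  shows "(\<integral>\<^sup>+\<omega>. ennreal (indicator A \<omega> * (norm (F \<omega>))\<^sup>2) \<partial>M)
    \<le> ennreal (c\<^sup>2 + \<sigma>\<^sup>2 * h) * (\<integral>\<^sup>+\<omega>. ennreal (indicator A \<omega> * (norm (D \<omega>))\<^sup>2) \<partial>M)"
proof -
  let ?V = "\<lambda>\<omega>. indicator A \<omega> *\<^sub>R D \<omega>"
  have V: "?V \<in> borel_measurable (past n)"
    by (rule borel_measurable_scaleR[OF indicator_measurable[OF A] D])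
  have "(\<integral>\<^sup>+\<omega>. ennreal (indicator A \<omega> * (norm (F \<omega>))\<^sup>2) \<partial>M)
      \<le> (\<integral>\<^sup>+\<omega>. ennreal ((norm (c *\<^sub>R ?V \<omega> + (\<sigma> * sqrt h) *\<^sub>R (?V \<omega> * \<eta> n \<omega>)))\<^sup>2) \<partial>M)"
    using le by (intro nn_integral_mono ennreal_leI) (auto simp: indicator_def intro!: power_mono)
  also have "\<dots> = ennreal (c\<^sup>2 + (\<sigma> * sqrt h)\<^sup>2) * (\<integral>\<^sup>+\<omega>. ennreal ((norm (?V \<omega>))\<^sup>2) \<partial>M)"
    by (rule noise_step_moment[OF V])
  also have "(\<integral>\<^sup>+\<omega>. ennreal ((norm (?V \<omega>))\<^sup>2) \<partial>M) = (\<integral>\<^sup>+\<omega>. ennreal (indicator A \<omega> * (norm (D \<omega>))\<^sup>2) \<partial>M)"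
    by (intro nn_integral_cong) (auto simp: indicator_def)
  also have "(\<sigma> * sqrt h)\<^sup>2 = \<sigma>\<^sup>2 * h"
    using pos by (simp add: power_mult_distrib)
  finally show ?thesis .
qed

text \<open>
  The weighted mean cancels in the difference of two predictors, and the projection onto a convex set
  is nonexpansive.
\<close>

lemma particle_distance_contracts:
  assumes A: "A \<in> sets (past 0)" and ij: "i \<in> {1..N}" "j \<in> {1..N}"
  shows "(\<integral>\<^sup>+\<omega>. ennreal (indicator A \<omega> * (norm (w n i \<omega> - w n j \<omega>))\<^sup>2) \<partial>M)
    \<le> ennreal (\<rho> ^ n) * (\<integral>\<^sup>+\<omega>. ennreal (indicator A \<omega> * (norm (w 0 i \<omega> - w 0 j \<omega>))\<^sup>2) \<partial>M)"
proof (induction n)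
  case 0
  then show ?case by simp
next
  case (Suc n)
  have "(\<integral>\<^sup>+\<omega>. ennreal (indicator A \<omega> * (norm (w (Suc n) i \<omega> - w (Suc n) j \<omega>))\<^sup>2) \<partial>M)
     \<le> ennreal \<rho> * (\<integral>\<^sup>+\<omega>. ennreal (indicator A \<omega> * (norm (w n i \<omega> - w n j \<omega>))\<^sup>2) \<partial>M)"
  proof (rule conditional_step_moment_le[OF A])
    show "(\<lambda>\<omega>. w n i \<omega> - w n j \<omega>) \<in> borel_measurable (past n)"
      by (intro borel_measurable_diff adapted ij)
    fix \<omega> assume "\<omega> \<in> space M"
    then show "norm (w (Suc n) i \<omega> - w (Suc n) j \<omega>)
      \<le> norm ((1 - lam * h) *\<^sub>R (w n i \<omega> - w n j \<omega>) + (\<sigma> * sqrt h) *\<^sub>R ((w n i \<omega> - w n j \<omega>) * \<eta> n \<omega>))"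
      unfolding step[OF ij(1) \<open>\<omega> \<in> space M\<close>] step[OF ij(2) \<open>\<omega> \<in> space M\<close>]
        predictor_diff[where y = "wbar n \<omega>", symmetric] dist_norm[symmetric]
      by (intro closest_point_lipschitz S)
  qed
  also have "\<dots> \<le> ennreal \<rho> * (ennreal (\<rho> ^ n) *
      (\<integral>\<^sup>+\<omega>. ennreal (indicator A \<omega> * (norm (w 0 i \<omega> - w 0 j \<omega>))\<^sup>2) \<partial>M))"
    by (rule mult_left_mono[OF Suc]) simp
  also have "\<dots> = ennreal (\<rho> ^ Suc n) *
      (\<integral>\<^sup>+\<omega>. ennreal (indicator A \<omega> * (norm (w 0 i \<omega> - w 0 j \<omega>))\<^sup>2) \<partial>M)"
    using \<rho>_pos by (simp add: ennreal_mult mult.assoc)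
  finally show ?case .
qed

text \<open>
  A particle lies in \<open>S\<close>, so it is its own projection, and a step is no longer than the displacement of
  the predictor. That displacement is governed by the distance to the weighted mean, hence by the
  contracting distances to the other particles.
\<close>

lemma displacement_le:
  assumes A: "A \<in> sets (past 0)" and i: "i \<in> {1..N}"
    and close: "\<And>\<omega> j. \<omega> \<in> A \<Longrightarrow> j \<in> {1..N} \<Longrightarrow> norm (w 0 i \<omega> - w 0 j \<omega>) \<le> 2 * r"
  shows "(\<integral>\<^sup>+\<omega>. ennreal (indicator A \<omega> * (norm (w (Suc n) i \<omega> - w n i \<omega>))\<^sup>2) \<partial>M)
    \<le> ennreal (4 * \<kappa> * N * r\<^sup>2 * \<rho> ^ n) * emeasure M A"
proof -
  have init: "(\<integral>\<^sup>+\<omega>. ennreal (indicator A \<omega> * (norm (w 0 i \<omega> - w 0 j \<omega>))\<^sup>2) \<partial>M)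
      \<le> ennreal (4 * r\<^sup>2) * emeasure M A" if "j \<in> {1..N}" for j
  proof -
    have "(\<integral>\<^sup>+\<omega>. ennreal (indicator A \<omega> * (norm (w 0 i \<omega> - w 0 j \<omega>))\<^sup>2) \<partial>M)
        \<le> (\<integral>\<^sup>+\<omega>. ennreal (4 * r\<^sup>2) * indicator A \<omega> \<partial>M)"
    proof (rule nn_integral_mono)
      fix \<omega>
      show "ennreal (indicator A \<omega> * (norm (w 0 i \<omega> - w 0 j \<omega>))\<^sup>2) \<le> ennreal (4 * r\<^sup>2) * indicator A \<omega>"
        using power_mono[OF close[OF _ that], of \<omega> 2] by (auto simp: indicator_def power_mult_distrib)
    qed
    then show ?thesis
      by (simp add: nn_integral_cmult_indicator initial_event[OF A])
  qed
  have "(\<integral>\<^sup>+\<omega>. ennreal (indicator A \<omega> * (norm (w (Suc n) i \<omega> - w n i \<omega>))\<^sup>2) \<partial>M)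
     \<le> ennreal ((- (lam * h))\<^sup>2 + \<sigma>\<^sup>2 * h) * (\<integral>\<^sup>+\<omega>. ennreal (indicator A \<omega> * (norm (w n i \<omega> - wbar n \<omega>))\<^sup>2) \<partial>M)"
  proof (rule conditional_step_moment_le[OF A])
    show "(\<lambda>\<omega>. w n i \<omega> - wbar n \<omega>) \<in> borel_measurable (past n)"
      by (intro borel_measurable_diff wbar_measurable adapted i)
    fix \<omega> assume \<omega>: "\<omega> \<in> space M"
    have "dist (w (Suc n) i \<omega>) (closest_point S (w n i \<omega>)) \<le>
      dist (cbo_predictor lam \<sigma> h (w n i \<omega>) (wbar n \<omega>) (\<eta> n \<omega>)) (w n i \<omega>)"
      unfolding step[OF i \<omega>] by (intro closest_point_lipschitz S)
    then show "norm (w (Suc n) i \<omega> - w n i \<omega>)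
      \<le> norm ((- (lam * h)) *\<^sub>R (w n i \<omega> - wbar n \<omega>) + (\<sigma> * sqrt h) *\<^sub>R ((w n i \<omega> - wbar n \<omega>) * \<eta> n \<omega>))"
      unfolding predictor_displacement[symmetric] dist_norm closest_point_self[OF in_S[OF i \<omega>]] .
  qed
  also have "\<dots> \<le> ennreal \<kappa> * (\<Sum>j\<in>{1..N}. \<integral>\<^sup>+\<omega>. ennreal (indicator A \<omega> * (norm (w n i \<omega> - w n j \<omega>))\<^sup>2) \<partial>M)"
  proof -
    have meas: "(\<lambda>\<omega>. ennreal (indicator A \<omega> * (norm (w n i \<omega> - w n j \<omega>))\<^sup>2)) \<in> borel_measurable M"
      if "j \<in> {1..N}" for j
      using w_measurable[OF i] w_measurable[OF that] initial_event[OF A] by measurable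
    have "(\<integral>\<^sup>+\<omega>. ennreal (indicator A \<omega> * (norm (w n i \<omega> - wbar n \<omega>))\<^sup>2) \<partial>M)
        \<le> (\<integral>\<^sup>+\<omega>. (\<Sum>j\<in>{1..N}. ennreal (indicator A \<omega> * (norm (w n i \<omega> - w n j \<omega>))\<^sup>2)) \<partial>M)"
      using norm_diff_weighted_mean_le[OF Npos]
      by (intro nn_integral_mono) (auto simp: indicator_def sum_ennreal intro!: ennreal_leI)
    also have "\<dots> = (\<Sum>j\<in>{1..N}. \<integral>\<^sup>+\<omega>. ennreal (indicator A \<omega> * (norm (w n i \<omega> - w n j \<omega>))\<^sup>2) \<partial>M)"
      by (rule nn_integral_sum) (rule meas)
    finally show ?thesis
      unfolding power2_minus by (rule mult_left_mono) simp
  qed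
  also have "\<dots> \<le> ennreal \<kappa> * (\<Sum>j\<in>{1..N}. ennreal (\<rho> ^ n) * (ennreal (4 * r\<^sup>2) * emeasure M A))"
    by (intro mult_left_mono sum_mono order_trans[OF particle_distance_contracts[OF A i] mult_left_mono[OF init]]) auto
  also have "\<dots> = ennreal (4 * \<kappa> * N * r\<^sup>2 * \<rho> ^ n) * emeasure M A"
  proof -
    have eq: "4 * \<kappa> * N * r\<^sup>2 * \<rho> ^ n = \<kappa> * (real N * (\<rho> ^ n * (4 * r\<^sup>2)))"
      by (simp add: mult_ac)
    show ?thesis
      unfolding eq using \<rho>_pos \<kappa>_nonneg by (simp add: ennreal_mult ennreal_of_nat_eq_real_of_nat mult.assoc)
  qed
  finally show ?thesis .
qed

text \<open>
  The inequality \<open>a \<le> b + a\<^sup>2 / b\<close> turns the second moment bound into one for the first moment, with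
  \<open>b\<close> equal to the expected size \<open>r \<rho>\<^bsup>n/2\<^esup>\<close> of a step. The result is linear in \<open>r\<close>.
\<close>

lemma mean_displacement_le:
  assumes A: "A \<in> sets (past 0)" and i: "i \<in> {1..N}" and r: "r > 0"
    and close: "\<And>\<omega> j. \<omega> \<in> A \<Longrightarrow> j \<in> {1..N} \<Longrightarrow> norm (w 0 i \<omega> - w 0 j \<omega>) \<le> 2 * r"
  shows "(\<integral>\<^sup>+\<omega>. ennreal (indicator A \<omega> * norm (w (Suc n) i \<omega> - w n i \<omega>)) \<partial>M)
    \<le> ennreal ((1 + 4 * \<kappa> * N) * r * sqrt \<rho> ^ n) * emeasure M A"
proof -
  define b where "b = r * sqrt \<rho> ^ n"
  have b: "b > 0"
    using r \<rho>_pos by (simp add: b_def)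
  have young: "a \<le> b + a\<^sup>2 / b" if "a \<ge> 0" for a
  proof (cases "a \<le> b")
    case False
    then have "a * b \<le> a * a" using that by (intro mult_left_mono) auto
    then have "a \<le> a\<^sup>2 / b" using b by (simp add: field_simps power2_eq_square)
    then show ?thesis using b by simp
  qed (use b in \<open>simp add: add_increasing2\<close>)
  have meas: "(\<lambda>\<omega>. ennreal (indicator A \<omega> * (norm (w (Suc n) i \<omega> - w n i \<omega>))\<^sup>2)) \<in> borel_measurable M"
    using w_measurable[OF i] initial_event[OF A] by measurable
  have "(\<integral>\<^sup>+\<omega>. ennreal (indicator A \<omega> * norm (w (Suc n) i \<omega> - w n i \<omega>)) \<partial>M)
      \<le> (\<integral>\<^sup>+\<omega>. ennreal b * indicator A \<omega> +
          ennreal (1 / b) * ennreal (indicator A \<omega> * (norm (w (Suc n) i \<omega> - w n i \<omega>))\<^sup>2) \<partial>M)"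
  proof (rule nn_integral_mono)
    fix \<omega>
    show "ennreal (indicator A \<omega> * norm (w (Suc n) i \<omega> - w n i \<omega>))
      \<le> ennreal b * indicator A \<omega> +
          ennreal (1 / b) * ennreal (indicator A \<omega> * (norm (w (Suc n) i \<omega> - w n i \<omega>))\<^sup>2)"
      using young[of "norm (w (Suc n) i \<omega> - w n i \<omega>)"] b
      by (auto simp: indicator_def ennreal_mult[symmetric] ennreal_plus[symmetric]
          simp del: ennreal_plus intro!: ennreal_leI)
  qed
  also have "\<dots> = ennreal b * emeasure M A +
      ennreal (1 / b) * (\<integral>\<^sup>+\<omega>. ennreal (indicator A \<omega> * (norm (w (Suc n) i \<omega> - w n i \<omega>))\<^sup>2) \<partial>M)"
    using meas initial_event[OF A]
    by (subst nn_integral_add) (auto simp: nn_integral_cmult_indicator nn_integral_cmult)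
  also have "\<dots> \<le> ennreal b * emeasure M A +
      ennreal (1 / b) * (ennreal (4 * \<kappa> * N * r\<^sup>2 * \<rho> ^ n) * emeasure M A)"
    by (intro add_left_mono mult_left_mono displacement_le[OF A i close]) auto
  also have "\<dots> = ennreal (b + 1 / b * (4 * \<kappa> * N * r\<^sup>2 * \<rho> ^ n)) * emeasure M A"
    using b \<rho>_pos \<kappa>_nonneg
    by (simp add: ennreal_mult[symmetric] mult.assoc[symmetric] distrib_right[symmetric]
        ennreal_plus[symmetric] del: ennreal_plus)
  also have "b + 1 / b * (4 * \<kappa> * N * r\<^sup>2 * \<rho> ^ n) = (1 + 4 * \<kappa> * N) * r * sqrt \<rho> ^ n"
  proof -
    have "r\<^sup>2 * \<rho> ^ n = b * b"
      using \<rho>_pos by (simp add: b_def power2_eq_square power_mult_distrib[symmetric])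
    then have "1 / b * (4 * \<kappa> * N * r\<^sup>2 * \<rho> ^ n) = 1 / b * (4 * \<kappa> * N * (b * b))"
      by (simp only: mult.assoc)
    also have "\<dots> = 4 * \<kappa> * N * b"
      using b by simp
    finally show ?thesis
      by (simp add: b_def algebra_simps)
  qed
  finally show ?thesis .
qed

text \<open>
  The sum over all \<open>n\<close> of the constants in \<open>mean_displacement_le\<close>, with the factor \<open>r\<close> removed.
\<close>

definition drift_const :: real where
  "drift_const = (1 + 4 * \<kappa> * N) / (1 - sqrt \<rho>)"

lemma drift_const_nonneg: "drift_const \<ge> 0"
  using \<kappa>_nonneg contraction by (simp add: drift_const_def)

lemma mean_drift_le:
  assumes A: "A \<in> sets (past 0)" and i: "i \<in> {1..N}" and r: "r > 0"
    and close: "\<And>\<omega> j. \<omega> \<in> A \<Longrightarrow> j \<in> {1..N} \<Longrightarrow> norm (w 0 i \<omega> - w 0 j \<omega>) \<le> 2 * r"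
  shows "(\<integral>\<^sup>+\<omega>. ennreal (indicator A \<omega> * norm (w K i \<omega> - w 0 i \<omega>)) \<partial>M)
    \<le> ennreal (drift_const * r) * emeasure M A"
proof -
  have q: "sqrt \<rho> \<ge> 0" "sqrt \<rho> < 1"
    using \<rho>_pos contraction by auto
  have meas: "(\<lambda>\<omega>. ennreal (indicator A \<omega> * norm (w (Suc n) i \<omega> - w n i \<omega>))) \<in> borel_measurable M" for n
    using w_measurable[OF i] initial_event[OF A] by measurable
  have "(\<integral>\<^sup>+\<omega>. ennreal (indicator A \<omega> * norm (w K i \<omega> - w 0 i \<omega>)) \<partial>M)
      \<le> (\<integral>\<^sup>+\<omega>. (\<Sum>n<K. ennreal (indicator A \<omega> * norm (w (Suc n) i \<omega> - w n i \<omega>))) \<partial>M)"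
  proof (rule nn_integral_mono)
    fix \<omega>
    have "norm (w K i \<omega> - w 0 i \<omega>) \<le> (\<Sum>n<K. norm (w (Suc n) i \<omega> - w n i \<omega>))"
      unfolding sum_lessThan_telescope[of "\<lambda>n. w n i \<omega>" K, symmetric] by (rule norm_sum)
    then show "ennreal (indicator A \<omega> * norm (w K i \<omega> - w 0 i \<omega>))
        \<le> (\<Sum>n<K. ennreal (indicator A \<omega> * norm (w (Suc n) i \<omega> - w n i \<omega>)))"
      by (auto simp: sum_ennreal indicator_def intro!: ennreal_leI)
  qed
  also have "\<dots> = (\<Sum>n<K. \<integral>\<^sup>+\<omega>. ennreal (indicator A \<omega> * norm (w (Suc n) i \<omega> - w n i \<omega>)) \<partial>M)"
    by (rule nn_integral_sum) (rule meas)
  also have "\<dots> \<le> (\<Sum>n<K. ennreal ((1 + 4 * \<kappa> * N) * r * sqrt \<rho> ^ n) * emeasure M A)"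
    by (intro sum_mono mean_displacement_le[OF A i r close])
  also have "\<dots> = ennreal (\<Sum>n<K. (1 + 4 * \<kappa> * N) * r * sqrt \<rho> ^ n) * emeasure M A"
    using r q \<kappa>_nonneg by (simp add: sum_distrib_right[symmetric] sum_ennreal)
  also have "\<dots> \<le> ennreal (drift_const * r) * emeasure M A"
  proof (intro mult_right_mono ennreal_leI)
    have "(\<Sum>n<K. sqrt \<rho> ^ n) \<le> (\<Sum>n. sqrt \<rho> ^ n)"
      using q by (intro sum_le_suminf summable_geometric) auto
    also have "\<dots> = 1 / (1 - sqrt \<rho>)"
      using q by (intro suminf_geometric) auto
    finally have "(1 + 4 * \<kappa> * N) * r * (\<Sum>n<K. sqrt \<rho> ^ n) \<le> (1 + 4 * \<kappa> * N) * r * (1 / (1 - sqrt \<rho>))"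
      using r \<kappa>_nonneg by (intro mult_left_mono) auto
    then show "(\<Sum>n<K. (1 + 4 * \<kappa> * N) * r * sqrt \<rho> ^ n) \<le> drift_const * r"
      by (simp add: sum_distrib_left drift_const_def)
  qed simp
  finally show ?thesis .
qed

lemma mean_total_drift_le:
  assumes A: "A \<in> sets (past 0)" and i: "i \<in> {1..N}" and r: "r > 0"
    and close: "\<And>\<omega> j. \<omega> \<in> A \<Longrightarrow> j \<in> {1..N} \<Longrightarrow> norm (w 0 i \<omega> - w 0 j \<omega>) \<le> 2 * r"
    and lim: "AE \<omega> in M. (\<lambda>n. w n i \<omega>) \<longlonglongrightarrow> w_inf \<omega>"
  shows "(\<integral>\<^sup>+\<omega>. ennreal (indicator A \<omega> * norm (w_inf \<omega> - w 0 i \<omega>)) \<partial>M)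
    \<le> ennreal (drift_const * r) * emeasure M A"
proof -
  have meas: "(\<lambda>\<omega>. ennreal (indicator A \<omega> * norm (w n i \<omega> - w 0 i \<omega>))) \<in> borel_measurable M" for n
    using w_measurable[OF i] initial_event[OF A] by measurable
  have "(\<integral>\<^sup>+\<omega>. ennreal (indicator A \<omega> * norm (w_inf \<omega> - w 0 i \<omega>)) \<partial>M)
      = (\<integral>\<^sup>+\<omega>. liminf (\<lambda>n. ennreal (indicator A \<omega> * norm (w n i \<omega> - w 0 i \<omega>))) \<partial>M)"
  proof (rule nn_integral_cong_AE, use lim in eventually_elim)
    fix \<omega> assume "(\<lambda>n. w n i \<omega>) \<longlonglongrightarrow> w_inf \<omega>"
    then have "(\<lambda>n. ennreal (indicator A \<omega> * norm (w n i \<omega> - w 0 i \<omega>)))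
        \<longlonglongrightarrow> ennreal (indicator A \<omega> * norm (w_inf \<omega> - w 0 i \<omega>))"
      by (intro tendsto_intros)
    from lim_imp_Liminf[OF _ this]
    show "ennreal (indicator A \<omega> * norm (w_inf \<omega> - w 0 i \<omega>))
        = liminf (\<lambda>n. ennreal (indicator A \<omega> * norm (w n i \<omega> - w 0 i \<omega>)))"
      by simp
  qed
  also have "\<dots> \<le> liminf (\<lambda>n. \<integral>\<^sup>+\<omega>. ennreal (indicator A \<omega> * norm (w n i \<omega> - w 0 i \<omega>)) \<partial>M)"
    by (rule nn_integral_liminf) (rule meas)
  also have "\<dots> \<le> liminf (\<lambda>n :: nat. ennreal (drift_const * r) * emeasure M A)"
    by (intro Liminf_mono always_eventually allI mean_drift_le[OF A i r close])
  also have "\<dots> = ennreal (drift_const * r) * emeasure M A"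
    by (simp add: Liminf_const)
  finally show ?thesis .
qed

text \<open>
  Otherwise \<open>L(w_inf)\<close> exceeds some \<open>u > L(x)\<close> almost surely, so \<open>w_inf\<close> keeps a fixed distance from \<open>x\<close>.
  But if all particles start very close to \<open>x\<close>, which has positive probability, they move much less
  than this distance in the mean.
\<close>

lemma ess_inf_consensus_le:
  assumes lip: "C-lipschitz_on S L" and x: "x \<in> S"
    and pos_prob: "\<And>r. r > 0 \<Longrightarrow> emeasure M {\<omega>\<in>space M. \<forall>i\<in>{1..N}. w 0 i \<omega> \<in> ball x r} > 0"
    and lim: "\<And>i. i \<in> {1..N} \<Longrightarrow> AE \<omega> in M. (\<lambda>n. w n i \<omega>) \<longlonglongrightarrow> w_inf \<omega>"
  shows "ess_inf M (\<lambda>\<omega>. L (w_inf \<omega>)) \<le> ereal (L x)"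
  unfolding ess_inf_def
proof (rule Sup_least, rule ccontr)
  fix z assume "z \<in> {z. AE \<omega> in M. z \<le> ereal (L (w_inf \<omega>))}"
  then have AEz: "AE \<omega> in M. z \<le> ereal (L (w_inf \<omega>))" by simp
  assume "\<not> z \<le> ereal (L x)"
  then obtain u where u: "ereal (L x) < ereal u" "ereal u < z"
    using ereal_dense2[of "ereal (L x)" z] by (auto simp: not_le)
  have C: "C \<ge> 0"
    using lip by (rule lipschitz_on_nonneg)
  define D where "D = drift_const"
  have D: "D \<ge> 0"
    using drift_const_nonneg by (simp add: D_def)
  \<comment> \<open>so small that \<open>L(w_inf) > u\<close> forces \<open>w_inf\<close> farther than \<open>(D + 2) r\<close> from \<open>x\<close>, hence farther
    than \<open>(D + 1) r\<close> from the start of a particle in \<open>A\<close>, while the mean movement is at most \<open>D r\<close>\<close>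
  define r where "r = (u - L x) / ((C + 1) * (D + 2))"
  have r: "r > 0"
    using u C D by (simp add: r_def)
  have u_eq: "u - L x = (C + 1) * ((D + 2) * r)"
    using C D by (simp add: r_def)
  define A where "A = {\<omega>\<in>space M. \<forall>i\<in>{1..N}. w 0 i \<omega> \<in> ball x r}"
  have A: "A \<in> sets (past 0)"
  proof -
    have "{\<omega>\<in>space (past 0). w 0 i \<omega> \<in> ball x r} \<in> sets (past 0)" if "i \<in> {1..N}" for i
      using measurable_sets[OF adapted[OF that, of 0], of "ball x r"]
      by (simp add: vimage_def Int_def conj_commute)
    then have "{\<omega>\<in>space (past 0). \<forall>i\<in>{1..N}. w 0 i \<omega> \<in> ball x r} \<in> sets (past 0)"
      by (intro sets.sets_Collect_finite_All) auto
    then show ?thesis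
      by (simp add: A_def)
  qed
  have one: "1 \<in> {1..N}" using Npos by simp
  have close: "norm (w 0 1 \<omega> - w 0 j \<omega>) \<le> 2 * r" if "\<omega> \<in> A" "j \<in> {1..N}" for \<omega> j
  proof -
    have "dist x (w 0 1 \<omega>) < r" "dist x (w 0 j \<omega>) < r"
      using that one by (auto simp: A_def)
    then show ?thesis
      using dist_triangle3[of "w 0 1 \<omega>" "w 0 j \<omega>" x] by (simp add: dist_norm)
  qed
  have far: "AE \<omega> in M. indicator A \<omega> * ((D + 1) * r) \<le> indicator A \<omega> * norm (w_inf \<omega> - w 0 1 \<omega>)"
    using AEz lim[OF one] AE_space
  proof eventually_elim
    fix \<omega> assume z: "z \<le> ereal (L (w_inf \<omega>))" and l: "(\<lambda>n. w n 1 \<omega>) \<longlonglongrightarrow> w_inf \<omega>" and \<omega>: "\<omega> \<in> space M"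
    have inS: "w_inf \<omega> \<in> S"
      using closed_sequentially[OF S(2) _ l] in_S[OF one \<omega>] by blast
    have "ereal u < ereal (L (w_inf \<omega>))"
      using u z by order
    then have "(C + 1) * ((D + 2) * r) < L (w_inf \<omega>) - L x"
      using u_eq by simp
    also have "\<dots> \<le> C * dist (w_inf \<omega>) x"
      using lipschitz_onD[OF lip inS x] by (simp add: dist_real_def)
    also have "\<dots> \<le> (C + 1) * dist (w_inf \<omega>) x"
      by (intro mult_right_mono) auto
    finally have "(D + 2) * r < dist (w_inf \<omega>) x"
      using C by simp
    moreover have "dist x (w 0 1 \<omega>) < r" if "\<omega> \<in> A"
      using that one by (auto simp: A_def)
    ultimately have "(D + 1) * r \<le> dist (w_inf \<omega>) (w 0 1 \<omega>)" if "\<omega> \<in> A"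
      using that dist_triangle[of "w_inf \<omega>" x "w 0 1 \<omega>"] by (simp add: algebra_simps dist_commute)
    then show "indicator A \<omega> * ((D + 1) * r) \<le> indicator A \<omega> * norm (w_inf \<omega> - w 0 1 \<omega>)"
      by (simp add: indicator_def dist_norm)
  qed
  have "ennreal ((D + 1) * r) * emeasure M A = (\<integral>\<^sup>+\<omega>. ennreal (indicator A \<omega> * ((D + 1) * r)) \<partial>M)"
    using initial_event[OF A] D r
    by (subst nn_integral_cmult_indicator[symmetric])
       (auto intro!: nn_integral_cong simp: indicator_def)
  also have "\<dots> \<le> (\<integral>\<^sup>+\<omega>. ennreal (indicator A \<omega> * norm (w_inf \<omega> - w 0 1 \<omega>)) \<partial>M)"
    using far by (intro nn_integral_mono_AE) (auto elim!: eventually_mono intro: ennreal_leI)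
  also have "\<dots> \<le> ennreal (D * r) * emeasure M A"
    unfolding D_def by (rule mean_total_drift_le[OF A one r close lim[OF one]])
  finally have "(D + 1) * r * measure M A \<le> D * r * measure M A"
    using D r by (simp add: emeasure_eq_measure ennreal_mult[symmetric])
  moreover have "measure M A > 0"
    using pos_prob[OF r] by (simp add: A_def emeasure_eq_measure)
  ultimately show False
    using mult_pos_pos[OF r, of "measure M A"] by (simp add: algebra_simps)
qed

end

section \<open>The consensus value and the best initial value\<close>

text \<open>The factor is \<open>1 - h m\<close> with \<open>m = 2 lam - lam\<^sup>2 h - \<sigma>\<^sup>2 > 0\<close>.\<close>

lemma contraction_factor_less_1:
  fixes lam \<sigma> h :: real
  assumes "\<sigma> > 0" "2 * lam > \<sigma>\<^sup>2" "0 < h" "h < (2 * lam - \<sigma>\<^sup>2) / lam\<^sup>2"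
  shows "(1 - lam * h)\<^sup>2 + \<sigma>\<^sup>2 * h < 1"
proof -
  have "\<sigma>\<^sup>2 > 0" using assms by simp
  then have "lam > 0" using assms(2) by linarith
  then have "lam\<^sup>2 * h < 2 * lam - \<sigma>\<^sup>2"
    using assms(4) by (simp add: field_simps)
  then have "h * (lam\<^sup>2 * h) < h * (2 * lam - \<sigma>\<^sup>2)"
    using assms(3) by simp
  then show ?thesis
    by (simp add: power2_eq_square algebra_simps)
qed

lemma (in prob_space) prob_iid_all_in_pos:
  fixes X :: "nat \<Rightarrow> 'a \<Rightarrow> 'b::topological_space"
  assumes indep: "indep_vars (\<lambda>_. borel) X {1..N}" and N: "N \<ge> 1"
    and law: "\<And>i. i \<in> {1..N} \<Longrightarrow> distr M borel (X i) = \<mu>"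
    and U: "open U" "emeasure \<mu> U > 0"
  shows "emeasure M {\<omega>\<in>space M. \<forall>i\<in>{1..N}. X i \<omega> \<in> U} > 0"
proof -
  have "prob (X i -` U \<inter> space M) > 0" if i: "i \<in> {1..N}" for i
  proof -
    have "X i \<in> borel_measurable M"
      using indep i by (auto simp: indep_vars_def)
    then have "emeasure \<mu> U = emeasure M (X i -` U \<inter> space M)"
      using U(1) by (simp add: law[OF i, symmetric] emeasure_distr)
    then show ?thesis
      using U(2) by (simp add: emeasure_eq_measure)
  qed
  then have "prob (\<Inter>i\<in>{1..N}. X i -` U \<inter> space M) > 0"
    using N U(1) by (subst indep_varsD_finite[OF indep]) (auto intro!: prod_pos)
  moreover have "(\<Inter>i\<in>{1..N}. X i -` U \<inter> space M) = {\<omega>\<in>space M. \<forall>i\<in>{1..N}. X i \<omega> \<in> U}"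
    using N by auto
  ultimately show ?thesis
    by (simp add: emeasure_eq_measure)
qed

theorem theorem3p6:
  fixes M :: "'w measure"
    and S :: "(real ^ 'd) set"
    and L :: "real ^ 'd \<Rightarrow> real"
    and C\<^sub>L Lstar \<epsilon> :: real
    and w_in :: "'w \<Rightarrow> real ^ 'd"
  assumes "prob_space M"
    and "S \<noteq> {}" and "closed S" and "convex S"
    and "bounded (L ` S)"
    and "C\<^sub>L-lipschitz_on S L"
    and "(INF v\<in>S. L v) = Lstar"
    and "w_in \<in> borel_measurable M" and "\<forall>\<omega>\<in>space M. w_in \<omega> \<in> S"
    and "integrable M (\<lambda>\<omega>. (norm (w_in \<omega>))\<^sup>2)"
    and "0 < \<epsilon>" and "\<epsilon> < 1"
  shows "\<exists>E :: real \<Rightarrow> real. (E \<longlongrightarrow> 0) at_top \<and>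
    (\<forall>(N :: nat) (lam :: real) (\<sigma> :: real) (h :: real) (\<beta> :: real) (m :: real)
      (\<eta> :: nat \<Rightarrow> 'w \<Rightarrow> real ^ 'd) (w :: nat \<Rightarrow> nat \<Rightarrow> 'w \<Rightarrow> real ^ 'd) (w_inf :: 'w \<Rightarrow> real ^ 'd).
        N \<ge> 1 \<longrightarrow> \<beta> > 0 \<longrightarrow>
        \<sigma> > 0 \<longrightarrow> 2 * lam > \<sigma>\<^sup>2 \<longrightarrow> 0 < h \<longrightarrow> h < (2 * lam - \<sigma>\<^sup>2) / lam\<^sup>2 \<longrightarrow>
        m = 2 * lam - lam\<^sup>2 * h - \<sigma>\<^sup>2 \<longrightarrow>
        (1 - \<epsilon>) * (\<integral>\<omega>. exp (- \<beta> * L (w_in \<omega>)) \<partial>M)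
          \<ge> \<beta> * C\<^sub>L * exp (- \<beta> * Lstar) * (real CARD('d) - 1) * (lam * h + \<sigma> * sqrt h)
             / (real CARD('d) * (1 - exp (- (h * m / 2)))) * sqrt (2 * vec_variance M w_in) \<longrightarrow>
        cbo_solution M S L N lam \<sigma> h \<beta> \<eta> w \<longrightarrow>
        prob_space.indep_vars M (\<lambda>_. borel) (w 0) {1..N} \<longrightarrow>
        (\<forall>i\<in>{1..N}. distr M borel (w 0 i) = distr M borel w_in) \<longrightarrow>
        w_inf \<in> borel_measurable M \<longrightarrow>
        (\<forall>i\<in>{1..N}. AE \<omega> in M. (\<lambda>n. w n i \<omega>) \<longlonglongrightarrow> w_inf \<omega>) \<longrightarrow>
        ess_inf M (\<lambda>\<omega>. L (w_inf \<omega>)) \<le> ess_inf M (\<lambda>\<omega>. L (w_in \<omega>)) + ereal (E \<beta>) \<and>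
        (\<forall>wstar. wstar \<in> S \<longrightarrow> (\<forall>v\<in>S. L wstar \<le> L v) \<longrightarrow>
           wstar \<in> measure_support (distr M borel w_in) \<longrightarrow>
           ess_inf M (\<lambda>\<omega>. L (w_inf \<omega>)) \<le> ereal (Lstar + E \<beta>)))"
proof (intro exI conjI allI impI)
  show "((\<lambda>_. 0 :: real) \<longlongrightarrow> 0) at_top"
    by simp
  interpret prob_space M by fact
  fix N :: nat and lam \<sigma> h \<beta> m :: real
    and \<eta> :: "nat \<Rightarrow> 'w \<Rightarrow> real ^ 'd" and w :: "nat \<Rightarrow> nat \<Rightarrow> 'w \<Rightarrow> real ^ 'd" and w_inf :: "'w \<Rightarrow> real ^ 'd"
  assume N: "N \<ge> 1"
    and params: "\<sigma> > 0" "2 * lam > \<sigma>\<^sup>2" "0 < h" "h < (2 * lam - \<sigma>\<^sup>2) / lam\<^sup>2"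
    and sol: "cbo_solution M S L N lam \<sigma> h \<beta> \<eta> w"
    and indep: "indep_vars (\<lambda>_. borel) (w 0) {1..N}"
    and law: "\<forall>i\<in>{1..N}. distr M borel (w 0 i) = distr M borel w_in"
    and lim: "\<forall>i\<in>{1..N}. AE \<omega> in M. (\<lambda>n. w n i \<omega>) \<longlonglongrightarrow> w_inf \<omega>"
  interpret cbo_run M S L N lam \<sigma> h \<beta> \<eta> w
    by unfold_locales
      (use assms N params sol lipschitz_on_continuous_on contraction_factor_less_1[OF params] in auto)
  have key: "ess_inf M (\<lambda>\<omega>. L (w_inf \<omega>)) \<le> ereal (L x)"
    if "x \<in> S" "x \<in> measure_support (distr M borel w_in)" for x
  proof (rule ess_inf_consensus_le[OF \<open>C\<^sub>L-lipschitz_on S L\<close> that(1)])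
    show "emeasure M {\<omega>\<in>space M. \<forall>i\<in>{1..N}. w 0 i \<omega> \<in> ball x r} > 0" if "r > 0" for r
      using that \<open>x \<in> measure_support _\<close> law
      by (intro prob_iid_all_in_pos[OF indep N]) (auto simp: measure_support_def)
    show "AE \<omega> in M. (\<lambda>n. w n i \<omega>) \<longlonglongrightarrow> w_inf \<omega>" if "i \<in> {1..N}" for i
      using lim that by blast
  qed
  have "AE x in distr M borel w_in. x \<in> measure_support (distr M borel w_in)"
    by (rule AE_in_measure_support) simp
  then have "AE \<omega> in M. w_in \<omega> \<in> measure_support (distr M borel w_in)"
    using \<open>w_in \<in> borel_measurable M\<close> by (rule AE_distrD[rotated])
  then have "AE \<omega> in M. ess_inf M (\<lambda>\<omega>. L (w_inf \<omega>)) \<le> ereal (L (w_in \<omega>))"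
    using AE_space by eventually_elim (use assms in \<open>auto intro: key\<close>)
  then have "ess_inf M (\<lambda>\<omega>. L (w_inf \<omega>)) \<le> ess_inf M (\<lambda>\<omega>. L (w_in \<omega>))"
    unfolding ess_inf_def[of M "\<lambda>\<omega>. L (w_in \<omega>)"] by (intro Sup_upper) simp
  then show "ess_inf M (\<lambda>\<omega>. L (w_inf \<omega>)) \<le> ess_inf M (\<lambda>\<omega>. L (w_in \<omega>)) + ereal 0"
    by simp
  fix wstar assume ws: "wstar \<in> S" "\<forall>v\<in>S. L wstar \<le> L v" "wstar \<in> measure_support (distr M borel w_in)"
  have "Lstar = L wstar"
    unfolding \<open>(INF v\<in>S. L v) = Lstar\<close>[symmetric]
    using ws by (intro cInf_eq_minimum) auto
  with key[OF ws(1,3)] show "ess_inf M (\<lambda>\<omega>. L (w_inf \<omega>)) \<le> ereal (Lstar + 0)"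
    by simp
qed

end
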